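(* Suppose $M:=\sum_{t=0}^\infty\big(\sup_{i\in\mathcal S,u\in U}|f(t,i,u)|+\delta(t)\big)<\infty$ and that the maps $u\mapsto f(t,i,u)$ and $u\mapsto p^u_i$ are continuous on $U$. Then, for $\pi\in\Pi$, $$\pi\text{ is a relaxed equilibrium for }J\iff\pi\in\Phi(\pi).$$ Moreover, for any $y\in\mathbb R^d$, $$y=V^\pi\text{ for some relaxed equilibrium }\pi\in\Pi\text{ for }J\iff y\in\Psi(y).$$
   Context: Setting (discrete time). $\mathbb N_0=\mathbb N\cup\{0\}$. Fix $\ell,d\in\mathbb N$; $U\subset\mathbb R^\ell$ is compact with Lebesgue measure $\mathrm{Leb}(U)>0$; $\mathcal S=\{1,\dots,d\}$. For each $u\in U$, $p^u=(p^u_{ij})_{i,j\in\mathcal S}$ is a stochastic matrix and $p^u_i\in\mathbb R^d$ is its $i$-th row. $\mathcal P(U)$ is the set of Borel probability measures on $U$. A relaxed feedback control is a map $\pi:\mathcal S\to\mathcal P(U)$; $\Pi$ is the set of all of them. Under $\pi$, $X^\pi=(X^\pi_k)_{k\in\mathbb N_0}$ is the $\mathcal S$-valued Markov chain such that, given $X_t=i$, an action $u$ is sampled from $\pi(i)$ and $X_{t+1}=j$ with probability $p^u_{ij}$ (so its transition probabilities are $\int_U p^u_{ij}\,\pi(i)(du)$). $\mathbb E_i$ is expectation given $X_0=i$. The reward is $f:[0,\infty)\times\mathcal S\times U\to\mathbb R$, and $f^\mu(t,i):=\int_U f(t,i,u)\mu(du)$ for $\mu\in\mathcal P(U)$. The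 discount function $\delta:[0,\infty)\to[0,1]$ is nonincreasing with $\delta(0)=1$. For $\pi\in\Pi$, $i\in\mathcal S$: $J^\pi(i):=\mathbb E_i\big[\sum_{k=0}^\infty f^{\pi(X^\pi_k)}(k,X^\pi_k)\big]$ and $V^\pi(i):=\mathbb E_i\big[\sum_{k=0}^\infty f^{\pi(X^\pi_k)}(1+k,X^\pi_k)\big]$, with $V^\pi=(V^\pi(1),\dots,V^\pi(d))\in\mathbb R^d$. For $\pi,\pi'\in\Pi$, $\pi'\otimes_1\pi$ means using $\pi'$ at time $0$ and $\pi$ at all times $\ge1$ (both for sampling actions and in the reward terms). $\pi\in\Pi$ is a relaxed equilibrium (for $J$) if $J^{\pi'\otimes_1\pi}(i)\le J^\pi(i)$ for all $i\in\mathcal S$ and $\pi'\in\Pi$. For $y\in\mathbb R^d$, $i\in\mathcal S$: $E(y,i):=\arg\max_{u\in U}\{f(0,i,u)+p^u_i\cdot y\}\subseteq U$; $\Gamma(y):=\{\pi\in\Pi:\operatorname{supp}(\pi(i))\subseteq E(y,i)\ \forall i\in\mathcal S\}$, where $\operatorname{supp}$ is the support of a measure; $\Psi(y):=\{V^\pi:\pi\in\Gamma(y)\}\subseteq\mathbb R^d$. For $\pi\in\Pi$, $\Phi(\pi):=\Gamma(V^\pi)\subseteq\Pi$. *)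

theory Defs
  imports "HOL-Probability.Probability"
begin

text \<open>
  The state space is a finite type \<open>'s\<close> (with \<open>d = CARD('s)\<close>) and actions live in \<open>U \<subseteq> real ^ 'l\<close>.
  The transition matrix under action \<open>u\<close> is \<open>p u :: real ^ 's ^ 's\<close>, so \<open>p u $ i\<close> is its \<open>i\<close>-th row.
\<close>

definition stochastic_matrix :: "real ^ 's ^ 's \<Rightarrow> bool" where
  "stochastic_matrix A \<longleftrightarrow> (\<forall>i j. 0 \<le> A $ i $ j) \<and> (\<forall>i. (\<Sum>j\<in>UNIV. A $ i $ j) = 1)"

definition prob_measures :: "'a::topological_space set \<Rightarrow> 'a measure set" where
  "prob_measures U = {\<mu>. prob_space \<mu> \<and> sets \<mu> = sets (restrict_space borel U)}"

definition supp :: "'a::topological_space measure \<Rightarrow> 'a set" where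
  "supp \<mu> = {u \<in> space \<mu>. \<forall>G. open G \<longrightarrow> u \<in> G \<longrightarrow> 0 < emeasure \<mu> (G \<inter> space \<mu>)}"

type_synonym ('s, 'a) control = "'s \<Rightarrow> 'a measure"

definition relaxed_controls :: "'a::topological_space set \<Rightarrow> ('s, 'a) control set" where
  "relaxed_controls U = {\<pi>. \<forall>i. \<pi> i \<in> prob_measures U}"

text \<open>
  Law of the successor of state \<open>i\<close> when the action is sampled from \<open>\<mu>\<close>. The function passed to
  \<open>embed_pmf\<close> is a probability mass function for the arguments of interest, see
  \<open>pmf_transition\<close> below.
\<close>

definition transition :: "('a \<Rightarrow> real ^ 's ^ 's) \<Rightarrow> 'a measure \<Rightarrow> 's::finite \<Rightarrow> 's pmf" where
  "transition p \<mu> i = embed_pmf (\<lambda>j. \<integral>u. p u $ i $ j \<partial>\<mu>)"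

text \<open>
  Controls may depend on time: \<open>\<sigma> k\<close> is the relaxed feedback control used at time \<open>k\<close>.
  The law of the controlled chain started in \<open>i\<close> is the measure on the path space
  \<open>nat \<Rightarrow> 's\<close> given by the Ionescu-Tulcea construction from the kernels below
  (the state at time 0 has law \<open>return_pmf i\<close>). Its finite-dimensional
  distributions are computed in \<open>measure_path_law\<close>.
\<close>

definition path_kernel ::
  "('a \<Rightarrow> real ^ 's ^ 's) \<Rightarrow> (nat \<Rightarrow> ('s, 'a) control) \<Rightarrow> 's::finite \<Rightarrow> nat \<Rightarrow> (nat \<Rightarrow> 's) \<Rightarrow> 's measure" where
  "path_kernel p \<sigma> i n \<omega> = measure_pmf
     (case n of 0 \<Rightarrow> return_pmf i | Suc k \<Rightarrow> transition p (\<sigma> k (\<omega> k)) (\<omega> k))"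

definition path_law ::
  "('a \<Rightarrow> real ^ 's ^ 's) \<Rightarrow> (nat \<Rightarrow> ('s, 'a) control) \<Rightarrow> 's::finite \<Rightarrow> (nat \<Rightarrow> 's) measure" where
  "path_law p \<sigma> i = projective_family.lim UNIV
     (Ionescu_Tulcea.CI (path_kernel p \<sigma> i) (\<lambda>_. count_space UNIV)) (\<lambda>_. count_space UNIV)"

definition relaxed_reward ::
  "(real \<Rightarrow> 's \<Rightarrow> 'a \<Rightarrow> real) \<Rightarrow> 'a measure \<Rightarrow> real \<Rightarrow> 's \<Rightarrow> real" where
  "relaxed_reward f \<mu> t i = (\<integral>u. f t i u \<partial>\<mu>)"

definition J :: "('a \<Rightarrow> real ^ 's ^ 's) \<Rightarrow> (real \<Rightarrow> 's \<Rightarrow> 'a \<Rightarrow> real)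
    \<Rightarrow> (nat \<Rightarrow> ('s, 'a) control) \<Rightarrow> 's::finite \<Rightarrow> real" where
  "J p f \<sigma> i = (\<integral>\<omega>. (\<Sum>k. relaxed_reward f (\<sigma> k (\<omega> k)) (real k) (\<omega> k)) \<partial>path_law p \<sigma> i)"

definition stationary :: "('s, 'a) control \<Rightarrow> nat \<Rightarrow> ('s, 'a) control" where
  "stationary \<pi> k = \<pi>"

definition V :: "('a \<Rightarrow> real ^ 's ^ 's) \<Rightarrow> (real \<Rightarrow> 's \<Rightarrow> 'a \<Rightarrow> real)
    \<Rightarrow> ('s::finite, 'a) control \<Rightarrow> real ^ 's" where
  "V p f \<pi> = (\<chi> i. \<integral>\<omega>. (\<Sum>k. relaxed_reward f (\<pi> (\<omega> k)) (1 + real k) (\<omega> k))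
                    \<partial>path_law p (stationary \<pi>) i)"

text \<open>\<open>\<pi>' \<otimes>\<^sub>1 \<pi>\<close>\<close>

definition concat1 :: "('s, 'a) control \<Rightarrow> ('s, 'a) control \<Rightarrow> nat \<Rightarrow> ('s, 'a) control" where
  "concat1 \<pi>' \<pi> k = (if k = 0 then \<pi>' else \<pi>)"

definition relaxed_equilibrium :: "'a::topological_space set \<Rightarrow> ('a \<Rightarrow> real ^ 's ^ 's)
    \<Rightarrow> (real \<Rightarrow> 's \<Rightarrow> 'a \<Rightarrow> real) \<Rightarrow> ('s::finite, 'a) control \<Rightarrow> bool" where
  "relaxed_equilibrium U p f \<pi> \<longleftrightarrow> \<pi> \<in> relaxed_controls U \<and>
     (\<forall>i. \<forall>\<pi>'\<in>relaxed_controls U. J p f (concat1 \<pi>' \<pi>) i \<le> J p f (stationary \<pi>) i)"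

definition argmax_actions :: "'a set \<Rightarrow> ('a \<Rightarrow> real ^ 's ^ 's)
    \<Rightarrow> (real \<Rightarrow> 's \<Rightarrow> 'a \<Rightarrow> real) \<Rightarrow> real ^ 's \<Rightarrow> 's::finite \<Rightarrow> 'a set" where
  "argmax_actions U p f y i = {u. is_arg_max (\<lambda>u. f 0 i u + p u $ i \<bullet> y) (\<lambda>u. u \<in> U) u}"

definition Gamma_map :: "'a::topological_space set \<Rightarrow> ('a \<Rightarrow> real ^ 's ^ 's)
    \<Rightarrow> (real \<Rightarrow> 's \<Rightarrow> 'a \<Rightarrow> real) \<Rightarrow> real ^ 's \<Rightarrow> ('s::finite, 'a) control set" where
  "Gamma_map U p f y = {\<pi> \<in> relaxed_controls U. \<forall>i. supp (\<pi> i) \<subseteq> argmax_actions U p f y i}"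

definition Psi_map :: "'a::topological_space set \<Rightarrow> ('a \<Rightarrow> real ^ 's ^ 's)
    \<Rightarrow> (real \<Rightarrow> 's::finite \<Rightarrow> 'a \<Rightarrow> real) \<Rightarrow> real ^ 's \<Rightarrow> (real ^ 's) set" where
  "Psi_map U p f y = V p f ` Gamma_map U p f y"

definition Phi_map :: "'a::topological_space set \<Rightarrow> ('a \<Rightarrow> real ^ 's ^ 's)
    \<Rightarrow> (real \<Rightarrow> 's \<Rightarrow> 'a \<Rightarrow> real) \<Rightarrow> ('s::finite, 'a) control \<Rightarrow> ('s, 'a) control set" where
  "Phi_map U p f \<pi> = Gamma_map U p f (V p f \<pi>)"


lemma pmf_transition:
  fixes p :: "'a::topological_space \<Rightarrow> real ^ 's::finite ^ 's"
  assumes \<mu>: "\<mu> \<in> prob_measures U"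
    and p: "\<And>u. u \<in> U \<Longrightarrow> stochastic_matrix (p u)"
    and cont: "continuous_on U (\<lambda>u. p u $ i)"
  shows "pmf (transition p \<mu> i) j = (\<integral>u. p u $ i $ j \<partial>\<mu>)"
proof -
  interpret prob_space \<mu>
    using \<mu> by (simp add: prob_measures_def)
  have sets: "sets \<mu> = sets (restrict_space borel U)"
    using \<mu> by (simp add: prob_measures_def)
  have space: "space \<mu> = U"
    using sets_eq_imp_space_eq[OF sets] by (simp add: space_restrict_space)
  have nn: "0 \<le> p u $ i $ j" if "u \<in> U" for u j
    using p[OF that] by (simp add: stochastic_matrix_def)
  have sum1: "(\<Sum>j\<in>UNIV. p u $ i $ j) = 1" if "u \<in> U" for u
    using p[OF that] by (simp add: stochastic_matrix_def)
  have le1: "p u $ i $ j \<le> 1" if "u \<in> U" for u j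
    using member_le_sum[of j UNIV "\<lambda>j. p u $ i $ j"] nn[OF that] sum1[OF that] by simp
  have meas: "(\<lambda>u. p u $ i $ j) \<in> borel_measurable \<mu>" for j
  proof -
    have "(\<lambda>u. p u $ i $ j) \<in> borel_measurable (restrict_space borel U)"
      by (intro borel_measurable_continuous_on_restrict continuous_on_component cont)
    then show ?thesis
      using measurable_cong_sets[OF sets refl] by blast
  qed
  have int: "integrable \<mu> (\<lambda>u. p u $ i $ j)" for j
    by (rule integrable_const_bound[where B=1]) (auto intro!: AE_I2 simp: space nn le1 meas)
  have nonneg: "0 \<le> (\<integral>u. p u $ i $ j \<partial>\<mu>)" for j
    by (rule integral_nonneg_AE) (auto intro!: AE_I2 simp: space nn)
  have "(\<Sum>j\<in>UNIV. \<integral>u. p u $ i $ j \<partial>\<mu>) = (\<integral>u. (\<Sum>j\<in>UNIV. p u $ i $ j) \<partial>\<mu>)"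
    by (simp add: Bochner_Integration.integral_sum int)
  also have "\<dots> = (\<integral>u. 1 \<partial>\<mu>)"
    by (rule Bochner_Integration.integral_cong) (auto simp: space sum1)
  also have "\<dots> = 1"
    by (simp add: prob_space)
  finally have total: "(\<Sum>j\<in>UNIV. \<integral>u. p u $ i $ j \<partial>\<mu>) = 1" .
  show ?thesis
    unfolding transition_def
  proof (rule pmf_embed_pmf[OF nonneg])
    show "(\<integral>\<^sup>+j. ennreal (\<integral>u. p u $ i $ j \<partial>\<mu>) \<partial>count_space UNIV) = 1"
      by (simp add: nn_integral_count_space_finite sum_ennreal nonneg total)
  qed
qed

lemma Ionescu_Tulcea_path_kernel:
  "Ionescu_Tulcea (path_kernel p \<sigma> i) (\<lambda>_. count_space (UNIV :: 's::finite set))"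
proof (rule Ionescu_Tulcea.intro)
  fix n
  show "path_kernel p \<sigma> i n \<in>
      measurable (PiM {0..<n} (\<lambda>_. count_space UNIV)) (subprob_algebra (count_space UNIV))"
  proof (cases n)
    case 0
    have "path_kernel p \<sigma> i 0 = (\<lambda>_. measure_pmf (return_pmf i))"
      by (auto simp: path_kernel_def)
    then show ?thesis
      using 0 by (simp add: measure_pmf_in_subprob_algebra)
  next
    case (Suc k)
    have "path_kernel p \<sigma> i n = (\<lambda>s. measure_pmf (transition p (\<sigma> k s) s)) \<circ> (\<lambda>\<omega>. \<omega> k)"
      by (auto simp: path_kernel_def Suc)
    also have "\<dots> \<in> measurable (PiM {0..<n} (\<lambda>_. count_space UNIV)) (subprob_algebra (count_space UNIV))"
      by (rule measurable_comp[where N = "count_space UNIV"])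
         (auto simp: Suc measure_pmf_in_subprob_algebra intro!: measurable_component_singleton)
    finally show ?thesis .
  qed
qed (simp add: path_kernel_def measure_pmf.prob_space_axioms)

lemma
  shows prob_space_path_law: "prob_space (path_law p \<sigma> i)"
    and sets_path_law: "sets (path_law p \<sigma> i) = sets (PiM UNIV (\<lambda>_. count_space UNIV))"
    and measure_path_law: "measure (path_law p \<sigma> i) {\<omega>. \<forall>k\<le>n. \<omega> k = x k} =
      (if x 0 = i then \<Prod>k<n. pmf (transition p (\<sigma> k (x k)) (x k)) (x (Suc k)) else 0)"
proof -
  let ?N = "\<lambda>_::nat. count_space (UNIV :: 'a set)"
  interpret IT: Ionescu_Tulcea "path_kernel p \<sigma> i" ?N
    by (rule Ionescu_Tulcea_path_kernel)
  have law: "path_law p \<sigma> i = IT.PF.lim"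
    by (simp add: path_law_def)
  show sets: "sets (path_law p \<sigma> i) = sets (PiM UNIV ?N)"
    by (simp add: law)
  have "emeasure IT.PF.lim (IT.PF.emb UNIV {} (space (PiM {} ?N))) = IT.CI {} (space (PiM {} ?N))"
    by (rule IT.lim) auto
  also have "\<dots> = 1"
    using IT.PF.prob_space_P[of "{}", THEN prob_space.emeasure_space_1] by (simp add: IT.PF.space_P)
  finally show "prob_space (path_law p \<sigma> i)"
    by (intro prob_spaceI) (auto simp: law prod_emb_def space_PiM vimage_def restrict_def)
  have sing: "{restrict x {0..<m}} \<in> sets (PiM {0..<m} ?N)" for m
  proof -
    have "{restrict x {0..<m}} = (\<Pi>\<^sub>E k\<in>{0..<m}. {x k})"
      by (subst PiE_singleton[of "restrict x {0..<m}" "{0..<m}", symmetric]) (auto intro!: PiE_cong)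
    then show ?thesis
      by (auto intro!: sets_PiM_I_finite)
  qed
  have C: "emeasure (IT.C 0 m (\<lambda>_. undefined)) {restrict x {0..<m}} =
      (\<Prod>k<m. ennreal (pmf (case k of 0 \<Rightarrow> return_pmf i
                              | Suc k \<Rightarrow> transition p (\<sigma> k (x k)) (x k)) (x k)))" for m
  proof (induction m)
    case 0
    then show ?case
      by (simp add: space_PiM PiE_def extensional_def PiM_empty restrict_def)
  next
    case (Suc m)
    let ?A = "{restrict x {0..<Suc m}}"
    let ?q = "ennreal (pmf (case m of 0 \<Rightarrow> return_pmf i
                              | Suc k \<Rightarrow> transition p (\<sigma> k (x k)) (x k)) (x m))"
    have sp: "space (IT.C 0 m (\<lambda>_. undefined)) = space (PiM {0..<m} ?N)"
      by (subst IT.space_C) (auto simp: space_PiM)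
    have st: "sets (IT.C 0 m (\<lambda>_. undefined)) = sets (PiM {0..<m} ?N)"
      by (subst IT.sets_C) (auto simp: space_PiM)
    have "emeasure (IT.C 0 (Suc m) (\<lambda>_. undefined)) ?A
        = (\<integral>\<^sup>+\<omega>. emeasure (IT.eP m \<omega>) ?A \<partial>IT.C 0 m (\<lambda>_. undefined))"
      using sing[of "Suc m"] IT.measurable_eP[of m]
      by (simp add: emeasure_bind[where N = "PiM {0..<Suc m} ?N"] sp
            measurable_cong_sets[OF st refl])
    also have "\<dots> = (\<integral>\<^sup>+\<omega>. ?q * indicator {restrict x {0..<m}} \<omega> \<partial>IT.C 0 m (\<lambda>_. undefined))"
    proof (rule nn_integral_cong)
      fix \<omega> assume "\<omega> \<in> space (IT.C 0 m (\<lambda>_. undefined))"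
      then have \<omega>: "\<omega> \<in> space (PiM {0..<m} ?N)"
        by (simp add: sp)
      then have ext: "\<omega> \<in> extensional {0..<m}"
        by (simp add: space_PiM PiE_def)
      have eq: "fun_upd \<omega> m -` ?A = (if \<omega> = restrict x {0..<m} then {x m} else {})"
      proof -
        have "fun_upd \<omega> m y = restrict x {0..<Suc m} \<longleftrightarrow> \<omega> = restrict x {0..<m} \<and> y = x m" for y
        proof
          assume L: "fun_upd \<omega> m y = restrict x {0..<Suc m}"
          have "\<omega> k = restrict x {0..<m} k" for k
            using fun_cong[OF L, of k] ext by (cases "k < m") (auto simp: extensional_def)
          with fun_cong[OF L, of m] show "\<omega> = restrict x {0..<m} \<and> y = x m"
            by auto
        qed (auto simp: fun_eq_iff)
        then show ?thesis
          by auto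
      qed
      have "emeasure (IT.eP m \<omega>) ?A = emeasure (path_kernel p \<sigma> i m \<omega>) (fun_upd \<omega> m -` ?A)"
        using IT.emeasure_eP[OF \<omega> sing[of "Suc m"]] by simp
      also have "\<dots> = ?q * indicator {restrict x {0..<m}} \<omega>"
        by (auto simp: eq path_kernel_def emeasure_pmf_single split: nat.split)
      finally show "emeasure (IT.eP m \<omega>) ?A = ?q * indicator {restrict x {0..<m}} \<omega>" .
    qed
    also have "\<dots> = ?q * emeasure (IT.C 0 m (\<lambda>_. undefined)) {restrict x {0..<m}}"
      using sing[of m] by (simp add: nn_integral_cmult_indicator st)
    finally show ?case
      by (simp add: Suc.IH mult.commute del: restrict_apply)
  qed
  have "\<omega> \<in> IT.PF.emb UNIV {0..<Suc n} {restrict x {0..<Suc n}} \<longleftrightarrow> (\<forall>k\<le>n. \<omega> k = x k)" for \<omega>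
    using restrict_ext[of "{0..<Suc n}" \<omega> x]
    by (auto simp: prod_emb_def space_PiM less_Suc_eq_le restrict_def dest: fun_cong split: if_splits)
  then have cyl: "{\<omega>. \<forall>k\<le>n. \<omega> k = x k} = IT.PF.emb UNIV {0..<Suc n} {restrict x {0..<Suc n}}"
    by blast
  have CI: "IT.CI {0..<Suc n} {restrict x {0..<Suc n}}
      = IT.C 0 (Suc n) (\<lambda>_. undefined) (IT.PF.emb {0..<Suc n} {0..<Suc n} {restrict x {0..<Suc n}})"
    by (rule IT.emeasure_CI[OF order_refl sing])
  have emb: "IT.PF.emb {0..<Suc n} {0..<Suc n} {restrict x {0..<Suc n}} = {restrict x {0..<Suc n}}"
    by (rule prod_emb_id) (auto simp: PiE_def)
  have "emeasure (path_law p \<sigma> i) {\<omega>. \<forall>k\<le>n. \<omega> k = x k} =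
      (\<Prod>k<Suc n. ennreal (pmf (case k of 0 \<Rightarrow> return_pmf i
                              | Suc k \<Rightarrow> transition p (\<sigma> k (x k)) (x k)) (x k)))"
    unfolding law cyl using IT.lim[OF _ sing[of "Suc n"]] CI C[of "Suc n"] emb by simp
  also have "\<dots> = ennreal (if x 0 = i then \<Prod>k<n. pmf (transition p (\<sigma> k (x k)) (x k)) (x (Suc k)) else 0)"
    by (auto simp: prod.lessThan_Suc_shift prod_ennreal indicator_def simp del: prod.lessThan_Suc)
  finally show "measure (path_law p \<sigma> i) {\<omega>. \<forall>k\<le>n. \<omega> k = x k} =
      (if x 0 = i then \<Prod>k<n. pmf (transition p (\<sigma> k (x k)) (x k)) (x (Suc k)) else 0)"
    by (simp add: measure_def prod_nonneg)
qed

end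

theory Submission
  imports Defs
begin

text \<open>
  By the Markov property at time 1, the payoff of \<open>\<pi>' \<otimes>\<^sub>1 \<pi>\<close> from \<open>i\<close> is the integral of
  \<open>h\<^sub>i u = f 0 i u + p u $ i \<bullet> V\<^sup>\<pi>\<close> against \<open>\<pi>' i\<close>. So \<open>\<pi>\<close> is an equilibrium iff each \<open>\<pi> i\<close>
  maximises the integral of the continuous function \<open>h\<^sub>i\<close> over all probability measures on the
  compact set \<open>U\<close>; comparing with Dirac measures, this means that \<open>\<pi> i\<close> is supported on the
  maximisers of \<open>h\<^sub>i\<close>. The second claim is the first one, with \<open>y\<close> in place of \<open>V\<^sup>\<pi>\<close>.
\<close>

section \<open>Coordinates of the controlled chain\<close>

lemma measurable_path_law_coordinate [measurable]:
  "(\<lambda>\<omega>. \<omega> k) \<in> measurable (path_law p \<sigma> i) (count_space UNIV)"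
  unfolding measurable_cong_sets[OF sets_path_law refl]
  by (rule measurable_component_singleton) simp

lemma space_path_law: "space (path_law p \<sigma> i) = UNIV"
  using sets_eq_imp_space_eq[OF sets_path_law] by (simp add: space_PiM PiE_def)

lemma cylinder_in_sets_path_law:
  "{\<omega>. \<forall>k\<le>n. \<omega> k = x k} \<in> sets (path_law p \<sigma> i)"
proof -
  have "{\<omega> \<in> space (path_law p \<sigma> i). \<forall>k\<in>{..n}. \<omega> k = x k} \<in> sets (path_law p \<sigma> i)"
    by measurable
  then show ?thesis
    by (simp add: Ball_def space_path_law)
qed

text \<open>For \<open>n = 0\<close> the product in the cylinder formula is empty, so the cylinder
  through \<open>i\<close> has mass 1.\<close>

lemma path_law_start_AE: "AE \<omega> in path_law p \<sigma> i. \<omega> 0 = i"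
proof -
  interpret prob_space "path_law p \<sigma> i"
    by (rule prob_space_path_law)
  have "measure (path_law p \<sigma> i) {\<omega>. \<omega> 0 = i} = 1"
    using measure_path_law[of p \<sigma> i 0 "\<lambda>_. i"] by simp
  then show ?thesis
    using prob_Collect_eq_1[of "\<lambda>\<omega>. \<omega> 0 = i"] cylinder_in_sets_path_law[of 0 "\<lambda>_. i" p \<sigma> i]
    by (simp add: space_path_law)
qed

text \<open>One-step Markov property for a time-dependent control. The event splits into finitely
  many cylinders, one per history up to time \<open>k\<close> ending in \<open>m\<close>, and
  extending each of them by \<open>j\<close> multiplies its mass by the same transition
  probability.\<close>

lemma measure_path_law_step:
  "measure (path_law p \<sigma> i) {\<omega>. \<omega> k = m \<and> \<omega> (Suc k) = j} =
   measure (path_law p \<sigma> i) {\<omega>. \<omega> k = m} * pmf (transition p (\<sigma> k m) m) j"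
proof -
  let ?P = "path_law p \<sigma> i"
  let ?cyl = "\<lambda>n x. {\<omega>. \<forall>k\<le>n. \<omega> k = x k}"
  interpret prob_space ?P
    by (rule prob_space_path_law)
  \<comment> \<open>Histories are extensional functions on \<open>{..k}\<close>: there are finitely
    many, and each cylinder is indexed exactly once.\<close>
  define X where "X = {x \<in> {..k} \<rightarrow>\<^sub>E (UNIV :: 'a set). x k = m}"
  have fin: "finite X"
    unfolding X_def by (intro finite_subset[OF _ finite_PiE[of "{..k}" "\<lambda>_. UNIV"]]) auto
  have eqI: "x = y" if "x \<in> X" "y \<in> X" "\<And>l. l \<le> k \<Longrightarrow> x l = y l" for x y
    using that by (intro PiE_ext[of x "{..k}" _ y]) (auto simp: X_def)
  have disj: "disjoint_family_on (?cyl k) X"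
    unfolding disjoint_family_on_def by (auto dest: eqI)
  \<comment> \<open>Two distinct histories differ at some \<open>l \<le> k\<close>, an index that
    the update at \<open>Suc k\<close> leaves alone.\<close>
  have disj': "disjoint_family_on (\<lambda>x. ?cyl (Suc k) (x(Suc k := j))) X"
    unfolding disjoint_family_on_def
  proof (intro ballI impI)
    fix x y assume xy: "x \<in> X" "y \<in> X" "x \<noteq> y"
    then obtain l where "l \<le> k" "x l \<noteq> y l"
      using eqI by blast
    then show "?cyl (Suc k) (x(Suc k := j)) \<inter> ?cyl (Suc k) (y(Suc k := j)) = {}"
      by (auto dest!: spec[of _ l])
  qed
  have un: "{\<omega>. \<omega> k = m} = (\<Union>x\<in>X. ?cyl k x)"
  proof (intro set_eqI iffI)
    fix \<omega> assume "\<omega> \<in> {\<omega>. \<omega> k = m}"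
    then show "\<omega> \<in> (\<Union>x\<in>X. ?cyl k x)"
      by (intro UN_I[of "restrict \<omega> {..k}"]) (auto simp: X_def)
  qed (auto simp: X_def)
  have un': "{\<omega>. \<omega> k = m \<and> \<omega> (Suc k) = j} = (\<Union>x\<in>X. ?cyl (Suc k) (x(Suc k := j)))"
  proof (intro set_eqI iffI)
    fix \<omega> assume "\<omega> \<in> {\<omega>. \<omega> k = m \<and> \<omega> (Suc k) = j}"
    then show "\<omega> \<in> (\<Union>x\<in>X. ?cyl (Suc k) (x(Suc k := j)))"
      by (intro UN_I[of "restrict \<omega> {..k}"]) (auto simp: X_def le_Suc_eq)
  next
    fix \<omega> assume "\<omega> \<in> (\<Union>x\<in>X. ?cyl (Suc k) (x(Suc k := j)))"
    then obtain x where x: "x \<in> X" and *: "\<And>l. l \<le> Suc k \<Longrightarrow> \<omega> l = (x(Suc k := j)) l"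
      by blast
    show "\<omega> \<in> {\<omega>. \<omega> k = m \<and> \<omega> (Suc k) = j}"
      using x *[of k] *[of "Suc k"] by (simp add: X_def)
  qed
  have "measure ?P {\<omega>. \<omega> k = m \<and> \<omega> (Suc k) = j} =
      (\<Sum>x\<in>X. measure ?P (?cyl (Suc k) (x(Suc k := j))))"
    unfolding un'
    by (rule finite_measure_finite_Union[OF fin _ disj']) (use cylinder_in_sets_path_law in blast)
  also have "\<dots> = (\<Sum>x\<in>X. measure ?P (?cyl k x) * pmf (transition p (\<sigma> k m) m) j)"
    \<comment> \<open>The longer product has one further factor, the transition from
      \<open>x k = m\<close> to \<open>j\<close>; the update at \<open>Suc k\<close> does not affect
      the others.\<close>
    by (rule sum.cong) (auto simp: measure_path_law X_def)
  also have "\<dots> = (\<Sum>x\<in>X. measure ?P (?cyl k x)) * pmf (transition p (\<sigma> k m) m) j"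
    by (simp add: sum_distrib_right)
  also have "(\<Sum>x\<in>X. measure ?P (?cyl k x)) = measure ?P {\<omega>. \<omega> k = m}"
    unfolding un
    by (rule finite_measure_finite_Union[OF fin _ disj, symmetric])
       (use cylinder_in_sets_path_law in blast)
  finally show ?thesis .
qed

section \<open>Expectations of functions of a single coordinate\<close>

lemma integrable_path_law_coordinate:
  fixes g :: "'s::finite \<Rightarrow> real"
  shows "integrable (path_law p \<sigma> i) (\<lambda>\<omega>. g (\<omega> k))"
proof -
  interpret prob_space "path_law p \<sigma> i"
    by (rule prob_space_path_law)
  show ?thesis
    by (rule integrable_const_bound[where B = "\<Sum>j\<in>UNIV. \<bar>g j\<bar>"])
       (auto intro!: AE_I2 member_le_sum)
qed

lemma integral_path_law_0:
  fixes g :: "'s::finite \<Rightarrow> real"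
  shows "(\<integral>\<omega>. g (\<omega> 0) \<partial>path_law p \<sigma> i) = g i"
proof -
  interpret prob_space "path_law p \<sigma> i"
    by (rule prob_space_path_law)
  have "(\<integral>\<omega>. g (\<omega> 0) \<partial>path_law p \<sigma> i) = (\<integral>\<omega>. g i \<partial>path_law p \<sigma> i)"
    by (rule integral_cong_AE) (auto intro: eventually_mono[OF path_law_start_AE])
  then show ?thesis
    by (simp add: prob_space)
qed

text \<open>The Markov property in terms of expectations. As there are finitely many states,
  \<open>g\<close> of the next state is a finite combination of indicators of pairs (state at
  \<open>k\<close>, state at \<open>Suc k\<close>), to which \<open>measure_path_law_step\<close>
  applies.\<close>

lemma integral_path_law_Suc:
  fixes g :: "'s::finite \<Rightarrow> real"
  shows "(\<integral>\<omega>. g (\<omega> (Suc k)) \<partial>path_law p \<sigma> i) =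
    (\<integral>\<omega>. (\<integral>j. g j \<partial>transition p (\<sigma> k (\<omega> k)) (\<omega> k)) \<partial>path_law p \<sigma> i)"
proof -
  let ?P = "path_law p \<sigma> i"
  let ?G = "\<lambda>m. \<integral>j. g j \<partial>transition p (\<sigma> k m) m"
  interpret prob_space ?P
    by (rule prob_space_path_law)
  \<comment> \<open>Only the pair \<open>m = \<omega> k\<close>, \<open>j = \<omega> (Suc k)\<close>
    contributes.\<close>
  have split: "(\<Sum>m\<in>UNIV. \<Sum>j\<in>UNIV. g j * indicat_real {\<omega>. \<omega> k = m \<and> \<omega> (Suc k) = j} \<omega>) =
      g (\<omega> (Suc k))" for \<omega>
  proof -
    have "(\<Sum>m\<in>UNIV. \<Sum>j\<in>UNIV. g j * indicat_real {\<omega>. \<omega> k = m \<and> \<omega> (Suc k) = j} \<omega>) =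
        (\<Sum>m\<in>UNIV. if \<omega> k = m then (\<Sum>j\<in>UNIV. if \<omega> (Suc k) = j then g j else 0) else 0)"
      by (intro sum.cong refl) (auto simp: indicator_def intro!: sum.cong)
    then show ?thesis
      by simp
  qed
  have set1: "{\<omega>. \<omega> k = m} \<in> sets ?P" for m
    using measurable_sets[OF measurable_path_law_coordinate[of k p \<sigma> i], of "{m}"]
    by (simp add: vimage_def space_path_law)
  have set2: "{\<omega>. \<omega> k = m \<and> \<omega> (Suc k) = j} \<in> sets ?P" for m j
  proof -
    have "{\<omega> \<in> space ?P. \<omega> k = m \<and> \<omega> (Suc k) = j} \<in> sets ?P"
      by measurable
    then show ?thesis
      by (simp add: space_path_law)
  qed
  have int1: "integrable ?P (\<lambda>\<omega>. c * indicat_real {\<omega>. \<omega> k = m} \<omega>)"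
    and int2: "integrable ?P (\<lambda>\<omega>. c * indicat_real {\<omega>. \<omega> k = m \<and> \<omega> (Suc k) = j} \<omega>)" for m j and c :: real
    using set1 set2 by (auto simp: emeasure_eq_measure)
  have "(\<integral>\<omega>. g (\<omega> (Suc k)) \<partial>?P) =
      (\<integral>\<omega>. (\<Sum>m\<in>UNIV. \<Sum>j\<in>UNIV. g j * indicat_real {\<omega>. \<omega> k = m \<and> \<omega> (Suc k) = j} \<omega>) \<partial>?P)"
    by (simp only: split)
  also have "\<dots> = (\<Sum>m\<in>UNIV. \<Sum>j\<in>UNIV. g j * measure ?P {\<omega>. \<omega> k = m \<and> \<omega> (Suc k) = j})"
    using int2 by (simp only: Bochner_Integration.integral_sum Bochner_Integration.integrable_sum)
      (simp add: space_path_law)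
  also have "\<dots> = (\<Sum>m\<in>UNIV. ?G m * measure ?P {\<omega>. \<omega> k = m})"
    by (simp add: measure_path_law_step integral_measure_pmf_real[of UNIV] sum_distrib_left mult_ac)
  also have "\<dots> = (\<integral>\<omega>. (\<Sum>m\<in>UNIV. ?G m * indicat_real {\<omega>. \<omega> k = m} \<omega>) \<partial>?P)"
    using int1 by (simp only: Bochner_Integration.integral_sum) (simp add: space_path_law)
  also have "\<dots> = (\<integral>\<omega>. ?G (\<omega> k) \<partial>?P)"
    by (rule Bochner_Integration.integral_cong) (simp_all add: indicator_def sum.delta')
  finally show ?thesis .
qed

text \<open>Markov property at time 1, for one coordinate at a time; rewards are additive over time,
  so this form suits the payoff. The induction peels off the last step, replacing \<open>g\<close>
  by its one-step mean under \<open>\<pi>\<close>, and so keeps \<open>g\<close> arbitrary.\<close>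

lemma integral_path_law_concat1:
  fixes g :: "'s::finite \<Rightarrow> real"
  shows "(\<integral>\<omega>. g (\<omega> (Suc k)) \<partial>path_law p (concat1 \<pi>' \<pi>) i) =
    (\<integral>m. (\<integral>\<omega>. g (\<omega> k) \<partial>path_law p (stationary \<pi>) m) \<partial>transition p (\<pi>' i) i)"
proof (induction k arbitrary: g)
  case 0
  show ?case
    unfolding integral_path_law_Suc concat1_def
    by (simp add: integral_path_law_0 integral_path_law_0[where g = "\<lambda>m. \<integral>j. g j \<partial>transition p (\<pi>' m) m"])
next
  case (Suc k)
  \<comment> \<open>The clocks of the two chains differ by one, but both use \<open>\<pi>\<close>
    here, so the same one-step mean replaces \<open>g\<close> on both sides.\<close>
  have "concat1 \<pi>' \<pi> (Suc k) = \<pi>" "stationary \<pi> k = \<pi>"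
    by (simp_all add: concat1_def stationary_def)
  then show ?case
    unfolding integral_path_law_Suc[where g = g]
    using Suc.IH[of "\<lambda>m. \<integral>j. g j \<partial>transition p (\<pi> m) m"] by simp
qed

text \<open>The uniform summable bound \<open>c\<close> makes the series absolutely convergent along
  every path and in mean, so sum and expectation may be exchanged.\<close>

lemma sums_integral_path_law:
  fixes r :: "nat \<Rightarrow> 's::finite \<Rightarrow> real"
  assumes bound: "\<And>k j. \<bar>r k j\<bar> \<le> c k" and c: "summable c"
  shows "(\<lambda>k. \<integral>\<omega>. r k (\<omega> k) \<partial>path_law p \<sigma> i) sums (\<integral>\<omega>. (\<Sum>k. r k (\<omega> k)) \<partial>path_law p \<sigma> i)"
proof -
  interpret prob_space "path_law p \<sigma> i"
    by (rule prob_space_path_law)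
  show ?thesis
  proof (rule sums_integral)
    show "integrable (path_law p \<sigma> i) (\<lambda>\<omega>. r k (\<omega> k))" for k
      by (rule integrable_path_law_coordinate)
    show "AE \<omega> in path_law p \<sigma> i. summable (\<lambda>k. norm (r k (\<omega> k)))"
      by (intro AE_I2 summable_comparison_test'[OF c]) (simp add: bound)
    show "summable (\<lambda>k. \<integral>\<omega>. norm (r k (\<omega> k)) \<partial>path_law p \<sigma> i)"
    proof (rule summable_comparison_test'[OF c])
      fix k :: nat
      have "(\<integral>\<omega>. \<bar>r k (\<omega> k)\<bar> \<partial>path_law p \<sigma> i) \<le> (\<integral>\<omega>. c k \<partial>path_law p \<sigma> i)"
        using integrable_path_law_coordinate[of p \<sigma> i "\<lambda>j. \<bar>r k j\<bar>" k]
        by (intro integral_mono) (auto simp: bound)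
      then show "norm (\<integral>\<omega>. norm (r k (\<omega> k)) \<partial>path_law p \<sigma> i) \<le> c k"
        by (simp add: prob_space)
    qed
  qed
qed

section \<open>Probability measures maximising an integral\<close>

lemma space_prob_measures:
  assumes "\<mu> \<in> prob_measures U"
  shows "space \<mu> = U"
  using assms sets_eq_imp_space_eq[of \<mu> "restrict_space borel U"]
  by (simp add: prob_measures_def space_restrict_space)

lemma integrable_prob_measures:
  fixes h :: "'a::topological_space \<Rightarrow> real"
  assumes \<mu>: "\<mu> \<in> prob_measures U" and U: "compact U" and h: "continuous_on U h"
  shows "integrable \<mu> h"
proof -
  interpret prob_space \<mu>
    using \<mu> by (simp add: prob_measures_def)
  have "sets \<mu> = sets (restrict_space borel U)"
    using \<mu> by (simp add: prob_measures_def)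
  then have meas: "h \<in> borel_measurable \<mu>"
    using borel_measurable_continuous_on_restrict[OF h] measurable_cong_sets by blast
  obtain B where "\<And>u. u \<in> U \<Longrightarrow> norm (h u) \<le> B"
    using compact_imp_bounded[OF compact_continuous_image[OF h U]] by (auto simp: bounded_iff)
  then show ?thesis
    by (intro integrable_const_bound[where B = B]) (auto simp: space_prob_measures[OF \<mu>] meas)
qed

section \<open>Supports and almost sure statements\<close>

lemma open_Int_space_in_sets:
  assumes \<mu>: "\<mu> \<in> prob_measures U" and G: "open G"
  shows "G \<inter> space \<mu> \<in> sets \<mu>"
proof -
  have "G \<inter> U \<in> sets (restrict_space borel U)"
    using G by (auto simp: sets_restrict_space)
  then show ?thesis
    using \<mu> by (simp add: space_prob_measures[OF \<mu>]) (simp add: prob_measures_def)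
qed

text \<open>The complement of the support is covered by open null sets. By second countability
  (Lindelof) countably many of them suffice, so it is itself null.\<close>

lemma AE_in_supp:
  fixes \<mu> :: "'a::second_countable_topology measure"
  assumes \<mu>: "\<mu> \<in> prob_measures U"
  shows "AE u in \<mu>. u \<in> supp \<mu>"
proof -
  define \<G> where "\<G> = {G. open G \<and> emeasure \<mu> (G \<inter> space \<mu>) = 0}"
  have "\<And>G. G \<in> \<G> \<Longrightarrow> open G"
    by (simp add: \<G>_def)
  then obtain \<H> where \<H>: "\<H> \<subseteq> \<G>" "countable \<H>" "\<Union>\<H> = \<Union>\<G>"
    by (rule Lindelof)
  have "(\<Union>G\<in>\<H>. G \<inter> space \<mu>) \<in> null_sets \<mu>"
  proof (rule null_sets_UN'[OF \<H>(2)])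
    fix G assume "G \<in> \<H>"
    then show "G \<inter> space \<mu> \<in> null_sets \<mu>"
      using \<H>(1) open_Int_space_in_sets[OF \<mu>, of G] by (auto simp: \<G>_def)
  qed
  moreover have "{u \<in> space \<mu>. u \<notin> supp \<mu>} \<subseteq> (\<Union>G\<in>\<H>. G \<inter> space \<mu>)"
  proof
    fix u assume u: "u \<in> {u \<in> space \<mu>. u \<notin> supp \<mu>}"
    then have "u \<in> \<Union>\<G>"
      by (auto simp: supp_def \<G>_def not_gr_zero)
    with u \<H>(3) show "u \<in> (\<Union>G\<in>\<H>. G \<inter> space \<mu>)"
      by auto
  qed
  ultimately show ?thesis
    by (rule AE_I')
qed

lemma supp_subset_of_AE_eq:
  fixes h :: "'a::topological_space \<Rightarrow> real"
  assumes \<mu>: "\<mu> \<in> prob_measures U" and h: "continuous_on U h" and ae: "AE u in \<mu>. h u = c"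
  shows "supp \<mu> \<subseteq> {u \<in> U. h u = c}"
proof
  fix u assume u: "u \<in> supp \<mu>"
  then have uU: "u \<in> U"
    by (simp add: supp_def space_prob_measures[OF \<mu>])
  moreover have "h u = c"
  proof (rule ccontr)
    assume "h u \<noteq> c"
    \<comment> \<open>The set where \<open>h\<close> differs from \<open>c\<close> is only
      relatively open in \<open>U\<close>, while \<open>supp\<close> tests with open sets of the
      whole space; \<open>G\<close> is an open set with this trace.\<close>
    obtain G where G: "open G" "G \<inter> U = h -` (- {c}) \<inter> U"
      using h open_Compl[OF closed_singleton[of c]] unfolding continuous_on_open_invariant by blast
    have "u \<in> G"
      using G(2) uU \<open>h u \<noteq> c\<close> by auto
    then have "emeasure \<mu> (G \<inter> space \<mu>) > 0"
      using u G(1) by (auto simp: supp_def)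
    moreover have "AE u in \<mu>. u \<notin> G \<inter> space \<mu>"
      using ae
    proof eventually_elim
      case (elim u)
      then show ?case
        using G(2) by (auto simp: space_prob_measures[OF \<mu>])
    qed
    then have "emeasure \<mu> (G \<inter> space \<mu>) = 0"
      by (intro null_setsD1) (simp add: AE_iff_null_sets open_Int_space_in_sets[OF \<mu> G(1)])
    ultimately show False
      by simp
  qed
  ultimately show "u \<in> {u \<in> U. h u = c}"
    by simp
qed

lemma return_in_prob_measures:
  assumes "u \<in> U"
  shows "return (restrict_space borel U) u \<in> prob_measures U"
  using assms by (simp add: prob_measures_def prob_space_return space_restrict_space)

text \<open>No integral exceeds the maximum \<open>h z\<close>, and the Dirac measure at
  \<open>z\<close> attains it. Hence \<open>\<mu>\<close> is optimal iff its integral equals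
  \<open>h z\<close>, iff \<open>h = h z\<close> almost everywhere, iff its support consists of
  maximisers.\<close>

lemma integral_maximal_iff_supp:
  fixes h :: "'a::second_countable_topology \<Rightarrow> real"
  assumes U: "compact U" and h: "continuous_on U h" and \<mu>: "\<mu> \<in> prob_measures U"
  shows "(\<forall>\<nu>\<in>prob_measures U. (\<integral>u. h u \<partial>\<nu>) \<le> (\<integral>u. h u \<partial>\<mu>)) \<longleftrightarrow>
    supp \<mu> \<subseteq> {u. is_arg_max h (\<lambda>u. u \<in> U) u}"
proof -
  interpret prob_space \<mu>
    using \<mu> by (simp add: prob_measures_def)
  \<comment> \<open>\<open>U\<close> carries a probability measure; nonemptiness is what lets
    \<open>h\<close> attain its maximum.\<close>
  have "U \<noteq> {}"
    using not_empty by (simp add: space_prob_measures[OF \<mu>])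
  then obtain z where z: "z \<in> U" and max: "\<And>u. u \<in> U \<Longrightarrow> h u \<le> h z"
    using continuous_attains_sup[OF U _ h] by blast
  have argmax: "{u. is_arg_max h (\<lambda>u. u \<in> U) u} = {u \<in> U. h u = h z}"
    using z max by (force simp: is_arg_max_linorder)
  note int = integrable_prob_measures[OF _ U h]
  have le: "(\<integral>u. h u \<partial>\<nu>) \<le> h z" if \<nu>: "\<nu> \<in> prob_measures U" for \<nu>
  proof -
    interpret \<nu>: prob_space \<nu>
      using \<nu> by (simp add: prob_measures_def)
    have "(\<integral>u. h u \<partial>\<nu>) \<le> (\<integral>u. h z \<partial>\<nu>)"
      by (rule integral_mono) (auto simp: int \<nu> max space_prob_measures[OF \<nu>])
    then show ?thesis
      by (simp add: \<nu>.prob_space)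
  qed
  show ?thesis
    unfolding argmax
  proof
    assume opt: "\<forall>\<nu>\<in>prob_measures U. (\<integral>u. h u \<partial>\<nu>) \<le> (\<integral>u. h u \<partial>\<mu>)"
    have "(\<integral>u. h u \<partial>return (restrict_space borel U) z) = h z"
      using z borel_measurable_continuous_on_restrict[OF h]
      by (intro integral_return) (auto simp: space_restrict_space)
    then have "h z \<le> (\<integral>u. h u \<partial>\<mu>)"
      using opt return_in_prob_measures[OF z] by metis
    \<comment> \<open>A nonnegative integrand with zero integral vanishes almost everywhere.\<close>
    then have "(\<integral>u. h z - h u \<partial>\<mu>) = 0"
      using le[OF \<mu>] by (simp add: int[OF \<mu>] prob_space)
    then have "AE u in \<mu>. h z - h u = 0"
      by (subst (asm) integral_nonneg_eq_0_iff_AE)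
         (auto simp: int[OF \<mu>] space_prob_measures[OF \<mu>] max)
    then show "supp \<mu> \<subseteq> {u \<in> U. h u = h z}"
      by (intro supp_subset_of_AE_eq[OF \<mu> h]) auto
  next
    assume "supp \<mu> \<subseteq> {u \<in> U. h u = h z}"
    then have "AE u in \<mu>. h u = h z"
      by (intro eventually_mono[OF AE_in_supp[OF \<mu>]]) auto
    then have "(\<integral>u. h u \<partial>\<mu>) = (\<integral>u. h z \<partial>\<mu>)"
      using int[OF \<mu>] by (intro integral_cong_AE) auto
    then show "\<forall>\<nu>\<in>prob_measures U. (\<integral>u. h u \<partial>\<nu>) \<le> (\<integral>u. h u \<partial>\<mu>)"
      using le by (simp add: prob_space)
  qed
qed

section \<open>One-step deviations\<close>

text \<open>Rewrites the mean continuation value as an integral over actions, so that it can be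
  merged with the immediate reward; a finite sum is exchanged with the integral.\<close>

lemma integral_transition:
  fixes p :: "'a::topological_space \<Rightarrow> real ^ 's::finite ^ 's"
  assumes \<mu>: "\<mu> \<in> prob_measures U" and U: "compact U"
    and p: "\<And>u. u \<in> U \<Longrightarrow> stochastic_matrix (p u)"
    and cont: "continuous_on U (\<lambda>u. p u $ i)"
  shows "(\<integral>j. y $ j \<partial>transition p \<mu> i) = (\<integral>u. p u $ i \<bullet> y \<partial>\<mu>)"
proof -
  have "integrable \<mu> (\<lambda>u. p u $ i $ j)" for j
    by (intro integrable_prob_measures[OF \<mu> U] continuous_on_component cont)
  then show ?thesis
    by (simp add: integral_measure_pmf_real[of UNIV] pmf_transition[OF \<mu> p cont] inner_vec_def
        Bochner_Integration.integral_sum mult_ac)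
qed

lemma abs_relaxed_reward_le:
  assumes \<mu>: "\<mu> \<in> prob_measures U" and U: "compact U" and cont: "continuous_on U (\<lambda>u. f t i u)"
    and bound: "\<And>u. u \<in> U \<Longrightarrow> \<bar>f t i u\<bar> \<le> c"
  shows "\<bar>relaxed_reward f \<mu> t i\<bar> \<le> c"
proof -
  interpret prob_space \<mu>
    using \<mu> by (simp add: prob_measures_def)
  have int: "integrable \<mu> (\<lambda>u. f t i u)"
    by (rule integrable_prob_measures[OF \<mu> U cont])
  have "\<bar>\<integral>u. f t i u \<partial>\<mu>\<bar> \<le> (\<integral>u. \<bar>f t i u\<bar> \<partial>\<mu>)"
    by (rule integral_abs_bound)
  also have "\<dots> \<le> (\<integral>u. c \<partial>\<mu>)"
    by (rule integral_mono) (auto simp: int bound space_prob_measures[OF \<mu>])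
  finally show ?thesis
    by (simp add: relaxed_reward_def prob_space)
qed

text \<open>The payoff is split after time 0. Its term at time \<open>Suc k\<close> is the mean,
  over the successor state, of term \<open>k\<close> of \<open>V\<close>: the shift
  \<open>1 + real k\<close> in \<open>V\<close> is precisely the time already elapsed.\<close>

lemma J_concat1:
  fixes p :: "'a::topological_space \<Rightarrow> real ^ 's::finite ^ 's"
  assumes U: "compact U"
    and p: "\<And>u. u \<in> U \<Longrightarrow> stochastic_matrix (p u)"
    and f_cont: "\<And>t i. t \<ge> 0 \<Longrightarrow> continuous_on U (\<lambda>u. f t i u)"
    and p_cont: "\<And>i. continuous_on U (\<lambda>u. p u $ i)"
    and bound: "\<And>k i u. u \<in> U \<Longrightarrow> \<bar>f (real k) i u\<bar> \<le> c k" and c: "summable c"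
    and \<pi>: "\<pi> \<in> relaxed_controls U" and \<pi>': "\<pi>' \<in> relaxed_controls U"
  shows "J p f (concat1 \<pi>' \<pi>) i = (\<integral>u. f 0 i u + p u $ i \<bullet> V p f \<pi> \<partial>\<pi>' i)"
proof -
  let ?q = "transition p (\<pi>' i) i"
  let ?r = "\<lambda>k j. relaxed_reward f (\<pi> j) (1 + real k) j"
  let ?r' = "\<lambda>k j. relaxed_reward f (concat1 \<pi>' \<pi> k j) (real k) j"
  let ?e = "\<lambda>k m. \<integral>\<omega>. ?r k (\<omega> k) \<partial>path_law p (stationary \<pi>) m"
  have \<mu>: "\<pi> j \<in> prob_measures U" "\<pi>' j \<in> prob_measures U" for j
    using \<pi> \<pi>' by (auto simp: relaxed_controls_def)
  have r': "\<bar>?r' k j\<bar> \<le> c k" for k j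
    by (rule abs_relaxed_reward_le[OF _ U]) (auto simp: concat1_def \<mu> f_cont bound)
  have r: "\<bar>?r k j\<bar> \<le> c (Suc k)" for k j
    using r'[of "Suc k" j] by (simp add: concat1_def add.commute)
  have "(\<lambda>k. ?e k m) sums (V p f \<pi> $ m)" for m
    using sums_integral_path_law[of ?r "\<lambda>k. c (Suc k)", OF r] c summable_Suc_iff[of c]
    by (simp add: V_def)
  \<comment> \<open>A mean over the successor state is a finite weighted sum, so the series for
    \<open>V\<close> may be averaged term by term.\<close>
  then have "(\<lambda>k. \<Sum>m\<in>UNIV. ?e k m * pmf ?q m) sums (\<Sum>m\<in>UNIV. V p f \<pi> $ m * pmf ?q m)"
    by (intro sums_sum sums_mult2)
  then have "(\<lambda>k. \<integral>m. ?e k m \<partial>?q) sums (\<integral>m. V p f \<pi> $ m \<partial>?q)"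
    by (simp add: integral_measure_pmf_real[of UNIV])
  moreover have "(\<integral>\<omega>. ?r' (Suc k) (\<omega> (Suc k)) \<partial>path_law p (concat1 \<pi>' \<pi>) i) = (\<integral>m. ?e k m \<partial>?q)" for k
    using integral_path_law_concat1[where g = "?r' (Suc k)"] by (simp add: concat1_def add.commute)
  ultimately have "(\<lambda>k. \<integral>\<omega>. ?r' (Suc k) (\<omega> (Suc k)) \<partial>path_law p (concat1 \<pi>' \<pi>) i) sums
      (\<integral>m. V p f \<pi> $ m \<partial>?q)"
    by simp
  \<comment> \<open>The series indexed from time 1 is re-indexed from time 0, which adds the
    immediate reward.\<close>
  then have "(\<lambda>k. \<integral>\<omega>. ?r' k (\<omega> k) \<partial>path_law p (concat1 \<pi>' \<pi>) i) sums
      ((\<integral>m. V p f \<pi> $ m \<partial>?q) + (\<integral>\<omega>. ?r' 0 (\<omega> 0) \<partial>path_law p (concat1 \<pi>' \<pi>) i))"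
    by (subst (asm) sums_Suc_iff) simp
  moreover have "(\<lambda>k. \<integral>\<omega>. ?r' k (\<omega> k) \<partial>path_law p (concat1 \<pi>' \<pi>) i) sums J p f (concat1 \<pi>' \<pi>) i"
    unfolding J_def by (rule sums_integral_path_law[OF r' c])
  ultimately have "J p f (concat1 \<pi>' \<pi>) i =
      (\<integral>m. V p f \<pi> $ m \<partial>?q) + (\<integral>\<omega>. ?r' 0 (\<omega> 0) \<partial>path_law p (concat1 \<pi>' \<pi>) i)"
    by (rule sums_unique2[symmetric])
  also have "(\<integral>\<omega>. ?r' 0 (\<omega> 0) \<partial>path_law p (concat1 \<pi>' \<pi>) i) = (\<integral>u. f 0 i u \<partial>\<pi>' i)"
    using integral_path_law_0[where g = "?r' 0"] by (simp add: relaxed_reward_def concat1_def)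
  also have "(\<integral>m. V p f \<pi> $ m \<partial>?q) = (\<integral>u. p u $ i \<bullet> V p f \<pi> \<partial>\<pi>' i)"
    by (rule integral_transition[OF \<mu>(2) U p p_cont])
  also have "(\<integral>u. p u $ i \<bullet> V p f \<pi> \<partial>\<pi>' i) + (\<integral>u. f 0 i u \<partial>\<pi>' i) =
      (\<integral>u. f 0 i u + p u $ i \<bullet> V p f \<pi> \<partial>\<pi>' i)"
    by (subst Bochner_Integration.integral_add)
       (auto intro!: integrable_prob_measures[OF \<mu>(2) U] f_cont continuous_on_inner p_cont
         continuous_on_const)
  finally show ?thesis .
qed

lemma relaxed_equilibrium_iff:
  fixes p :: "'a::second_countable_topology \<Rightarrow> real ^ 's::finite ^ 's"
  assumes U: "compact U"
    and p: "\<And>u. u \<in> U \<Longrightarrow> stochastic_matrix (p u)"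
    and f_cont: "\<And>t i. t \<ge> 0 \<Longrightarrow> continuous_on U (\<lambda>u. f t i u)"
    and p_cont: "\<And>i. continuous_on U (\<lambda>u. p u $ i)"
    and bound: "\<And>k i u. u \<in> U \<Longrightarrow> \<bar>f (real k) i u\<bar> \<le> c k" and c: "summable c"
  shows "relaxed_equilibrium U p f \<pi> \<longleftrightarrow> \<pi> \<in> Phi_map U p f \<pi>"
proof (cases "\<pi> \<in> relaxed_controls U")
  case True
  let ?h = "\<lambda>i u. f 0 i u + p u $ i \<bullet> V p f \<pi>"
  have \<pi>: "\<pi> i \<in> prob_measures U" for i
    using True by (simp add: relaxed_controls_def)
  note J = J_concat1[OF U p f_cont p_cont bound c True]
  have h: "continuous_on U (?h i)" for i
    by (intro continuous_on_add f_cont continuous_on_inner p_cont continuous_on_const) simp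
  \<comment> \<open>Not deviating is the deviation to \<open>\<pi>\<close> itself, so
    \<open>J_concat1\<close> evaluates both sides of the equilibrium inequality with the same
    \<open>V p f \<pi>\<close>.\<close>
  have st: "stationary \<pi> = concat1 \<pi> \<pi>"
    by (auto simp: stationary_def concat1_def)
  have "relaxed_equilibrium U p f \<pi> \<longleftrightarrow>
      (\<forall>i. \<forall>\<pi>'\<in>relaxed_controls U. (\<integral>u. ?h i u \<partial>\<pi>' i) \<le> (\<integral>u. ?h i u \<partial>\<pi> i))"
    by (simp add: relaxed_equilibrium_def st J True)
  also have "\<dots> \<longleftrightarrow> (\<forall>i. \<forall>\<nu>\<in>prob_measures U. (\<integral>u. ?h i u \<partial>\<nu>) \<le> (\<integral>u. ?h i u \<partial>\<pi> i))"
  proof (intro all_cong1 iffI ballI)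
    fix i \<nu>
    assume "\<forall>\<pi>'\<in>relaxed_controls U. (\<integral>u. ?h i u \<partial>\<pi>' i) \<le> (\<integral>u. ?h i u \<partial>\<pi> i)"
      and "\<nu> \<in> prob_measures U"
    \<comment> \<open>Only the value of \<open>\<pi>'\<close> at \<open>i\<close> matters, so the
      constant control \<open>\<lambda>_. \<nu>\<close> tests an arbitrary measure
      \<open>\<nu>\<close>.\<close>
    then show "(\<integral>u. ?h i u \<partial>\<nu>) \<le> (\<integral>u. ?h i u \<partial>\<pi> i)"
      by (auto simp: relaxed_controls_def dest: bspec[of _ _ "\<lambda>_. \<nu>"])
  qed (auto simp: relaxed_controls_def)
  also have "\<dots> \<longleftrightarrow> \<pi> \<in> Phi_map U p f \<pi>"
    by (simp add: integral_maximal_iff_supp[OF U h \<pi>] Phi_map_def Gamma_map_def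
        argmax_actions_def True)
  finally show ?thesis .
qed (simp add: relaxed_equilibrium_def Phi_map_def Gamma_map_def)

section \<open>A real summable bound from the assumption, and the conclusion\<close>

lemma summable_enn2real:
  assumes "(\<Sum>k. a k) < (\<infinity> :: ennreal)"
  shows "summable (\<lambda>k. enn2real (a k))"
proof -
  \<comment> \<open>\<open>enn2real\<close> sends \<open>top\<close> to 0, so it preserves the terms
    only once they are known to be finite.\<close>
  have "a k \<noteq> top" for k
    using ennreal_suminf_lessD[OF assms, of k] by simp
  then have "(\<Sum>k. ennreal (enn2real (a k))) \<noteq> top"
    using assms by (simp add: less_top)
  then show ?thesis
    by (intro summable_suminf_not_top) auto
qed

theorem proposition2p2:
  fixes U :: "(real ^ 'l) set"
    and p :: "real ^ 'l \<Rightarrow> real ^ 's ^ 's"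
    and f :: "real \<Rightarrow> 's::finite \<Rightarrow> real ^ 'l \<Rightarrow> real"
    and \<delta> :: "real \<Rightarrow> real"
  assumes "compact U" and "emeasure lborel U > 0"
    and "\<And>u. u \<in> U \<Longrightarrow> stochastic_matrix (p u)"
    and "\<And>t. t \<ge> 0 \<Longrightarrow> \<delta> t \<in> {0..1}" and "antimono_on {0..} \<delta>" and "\<delta> 0 = 1"
    and "(\<Sum>t. (SUP (i, u) \<in> UNIV \<times> U. ennreal \<bar>f (real t) i u\<bar>) + ennreal (\<delta> (real t))) < \<infinity>"
    and "\<And>t i. t \<ge> 0 \<Longrightarrow> continuous_on U (\<lambda>u. f t i u)"
    and "\<And>i. continuous_on U (\<lambda>u. p u $ i)"
  shows "(\<forall>\<pi>\<in>relaxed_controls U. relaxed_equilibrium U p f \<pi> \<longleftrightarrow> \<pi> \<in> Phi_map U p f \<pi>) \<and>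
    (\<forall>y. (\<exists>\<pi>\<in>relaxed_controls U. relaxed_equilibrium U p f \<pi> \<and> y = V p f \<pi>) \<longleftrightarrow> y \<in> Psi_map U p f y)"
proof -
  \<comment> \<open>The summand of the assumption; its real value is the dominating sequence
    \<open>c\<close> of the earlier lemmas.\<close>
  define a where "a k = (SUP (i, u) \<in> UNIV \<times> U. ennreal \<bar>f (real k) i u\<bar>) + ennreal (\<delta> (real k))" for k
  have a: "(\<Sum>k. a k) < \<infinity>"
    using assms(7) by (simp add: a_def)
  have bound: "\<bar>f (real k) i u\<bar> \<le> enn2real (a k)" if "u \<in> U" for k i u
  proof -
    have "ennreal \<bar>f (real k) i u\<bar> \<le> (SUP (i, u) \<in> UNIV \<times> U. ennreal \<bar>f (real k) i u\<bar>)"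
      using that by (intro SUP_upper2[of "(i, u)"]) auto
    also have "\<dots> \<le> a k"
      by (simp add: a_def)
    finally have "ennreal \<bar>f (real k) i u\<bar> \<le> a k" .
    from enn2real_mono[OF this] show ?thesis
      using ennreal_suminf_lessD[OF a, of k] by simp
  qed
  have iff: "relaxed_equilibrium U p f \<pi> \<longleftrightarrow> \<pi> \<in> Phi_map U p f \<pi>" for \<pi>
    by (rule relaxed_equilibrium_iff[OF assms(1,3,8,9) bound summable_enn2real[OF a]])
  show ?thesis
    \<comment> \<open>A witness of \<open>y \<in> Psi_map U p f y\<close> is a \<open>\<pi>\<close>
      in \<open>Gamma_map U p f y\<close> with \<open>y = V p f \<pi>\<close>, which is a fixed
      point of \<open>Phi_map\<close>.\<close>
    by (auto simp: iff Psi_map_def Phi_map_def Gamma_map_def)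
qed

end
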